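(* Let $q,r\ge 2$ be integers and $0<\alpha<1$. Let $P=P_\alpha$ be the transition matrix on the Diestel–Leader graph $\mathrm{DL}(q,r)$ and let $P_1$, $P_2$ be its projections onto the trees $\mathbb{T}_q$ and $\mathbb{T}_r$, as defined in the context. If $h:\mathrm{DL}(q,r)\to[0,\infty)$ is a non-negative $P$-harmonic function, then there are a non-negative $P_1$-harmonic function $h_1$ on $\mathbb{T}_q$ and a non-negative $P_2$-harmonic function $h_2$ on $\mathbb{T}_r$ such that $$h(x_1x_2)=h_1(x_1)+h_2(x_2)\quad\text{for all } x_1x_2\in \mathrm{DL}(q,r).$$
   Context: Trees. For an integer $q\ge 2$, $\mathbb{T}_q$ is the homogeneous tree in which every vertex has degree $q+1$, with graph distance $d$. An end is an equivalence class of geodesic rays (one-sided infinite geodesic paths), two rays being equivalent if their symmetric difference is finite. For a vertex $x$ and an end $\xi$, $\overline{x\,\xi}$ denotes the unique ray starting at $x$ and representing $\xi$. Fix a root vertex $o$ and a reference end $\omega$. For vertices $x,y$, the confluent $b=x\curlywedge y$ with respect to $\omega$ is the vertex defined by $\overline{x\,\omega}\cap\overline{y\,\omega}=\overline{b\,\omega}$. The Busemann function is $\mathfrak{h}(x)=d(x,x\curlywedge o)-d(o,x\curlywedge o)\in\mathbb{Z}$. Every vertex $x$ has exactly one neighbour $x^-$ (its predecessor) with $\mathfrak{h}(x^-)=\mathfrak{h}(x)-1$, and $q$ neighbours $y$ (its successors, satisfying $y^-=x$) with $\mathfrak{h}(y)=\mathfrak{h}(x)+1$. Diestel–Leader graph.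 Let $q,r\ge2$, and let $\mathbb{T}_q$, $\mathbb{T}_r$ have roots $o_1,o_2$ and reference ends $\omega_1,\omega_2$, respectively; $\mathfrak{h}$ and $x\mapsto x^-$ are taken in each tree with respect to its own root and reference end. The graph $\mathrm{DL}(q,r)$ has vertex set $\{x_1x_2=(x_1,x_2)\in\mathbb{T}_q\times\mathbb{T}_r:\mathfrak{h}(x_1)+\mathfrak{h}(x_2)=0\}$, and $x_1x_2\sim y_1y_2$ if and only if $x_1\sim y_1$ and $x_2\sim y_2$. Random walks. For $0<\alpha<1$, $P=P_\alpha$ on $\mathrm{DL}(q,r)$ is given by $p(x_1x_2,y_1y_2)=\alpha/q$ if $y_1^-=x_1$ and $y_2=x_2^-$; $=(1-\alpha)/r$ if $y_1=x_1^-$ and $y_2^-=x_2$; and $=0$ otherwise. The projection $P_1$ on $\mathbb{T}_q$ is given by $p_1(x_1,y_1)=\alpha/q$ if $y_1^-=x_1$; $=1-\alpha$ if $y_1=x_1^-$; $=0$ otherwise. The projection $P_2$ on $\mathbb{T}_r$ is given by $p_2(x_2,y_2)=\alpha$ if $y_2=x_2^-$; $=(1-\alpha)/r$ if $y_2^-=x_2$; $=0$ otherwise. Harmonic functions. For a transition matrix $R=(\rho(x,y))$ on a countable set $X$, a function $h:X\to\mathbb{R}$ is $R$-harmonic if $\sum_{y}\rho(x,y)h(y)=h(x)$ for all $x\in X$. *)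

theory Defs
  imports "HOL-Analysis.Infinite_Sum"
begin

text \<open>
  A graph is given by its adjacency relation \<open>E\<close>; its vertex set is the whole type.
\<close>

definition simple_graph :: "('a \<Rightarrow> 'a \<Rightarrow> bool) \<Rightarrow> bool" where
  "simple_graph E \<longleftrightarrow> symp E \<and> irreflp E"

definition connected_graph :: "('a \<Rightarrow> 'a \<Rightarrow> bool) \<Rightarrow> bool" where
  "connected_graph E \<longleftrightarrow> (\<forall>x y. E\<^sup>*\<^sup>* x y)"

definition is_cycle :: "('a \<Rightarrow> 'a \<Rightarrow> bool) \<Rightarrow> 'a list \<Rightarrow> bool" where
  "is_cycle E xs \<longleftrightarrow>
     length xs \<ge> 3 \<and> distinct xs \<and> successively E xs \<and> E (last xs) (hd xs)"

definition is_tree :: "('a \<Rightarrow> 'a \<Rightarrow> bool) \<Rightarrow> bool" where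
  "is_tree E \<longleftrightarrow> simple_graph E \<and> connected_graph E \<and> (\<nexists>xs. is_cycle E xs)"

text \<open>
  The tree \<open>\<T>\<^sub>q\<close> is determined up to isomorphism by this predicate. Finiteness of the
  neighbourhoods is implied, since the cardinality of an infinite set is \<open>0\<close>.
\<close>

definition homogeneous_tree :: "nat \<Rightarrow> ('a \<Rightarrow> 'a \<Rightarrow> bool) \<Rightarrow> bool" where
  "homogeneous_tree q E \<longleftrightarrow> is_tree E \<and> (\<forall>x. card {y. E x y} = q + 1)"

definition gdist :: "('a \<Rightarrow> 'a \<Rightarrow> bool) \<Rightarrow> 'a \<Rightarrow> 'a \<Rightarrow> nat" where
  "gdist E x y = (LEAST n. (E ^^ n) x y)"

definition geodesic_rays :: "('a \<Rightarrow> 'a \<Rightarrow> bool) \<Rightarrow> (nat \<Rightarrow> 'a) set" where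
  "geodesic_rays E = {\<rho>. \<forall>m n. int (gdist E (\<rho> m) (\<rho> n)) = \<bar>int m - int n\<bar>}"

definition ray_equiv :: "('a \<Rightarrow> 'a \<Rightarrow> bool) \<Rightarrow> ((nat \<Rightarrow> 'a) \<times> (nat \<Rightarrow> 'a)) set" where
  "ray_equiv E = {(\<rho>, \<sigma>). \<rho> \<in> geodesic_rays E \<and> \<sigma> \<in> geodesic_rays E \<and>
     finite ((range \<rho> - range \<sigma>) \<union> (range \<sigma> - range \<rho>))}"

definition ends :: "('a \<Rightarrow> 'a \<Rightarrow> bool) \<Rightarrow> (nat \<Rightarrow> 'a) set set" where
  "ends E = geodesic_rays E // ray_equiv E"

text \<open>An end is a set of rays, so \<open>\<rho> \<in> \<xi>\<close> says that \<open>\<rho>\<close> represents \<open>\<xi>\<close>.\<close>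

definition ray_to :: "'a \<Rightarrow> (nat \<Rightarrow> 'a) set \<Rightarrow> nat \<Rightarrow> 'a" where
  "ray_to x \<xi> = (THE \<rho>. \<rho> \<in> \<xi> \<and> \<rho> 0 = x)"

definition confluent :: "(nat \<Rightarrow> 'a) set \<Rightarrow> 'a \<Rightarrow> 'a \<Rightarrow> 'a" where
  "confluent \<omega> x y =
     (THE b. range (ray_to x \<omega>) \<inter> range (ray_to y \<omega>) = range (ray_to b \<omega>))"

text \<open>Below, \<open>v\<close> is the root and \<open>\<omega>\<close> the reference end.\<close>

definition busemann :: "('a \<Rightarrow> 'a \<Rightarrow> bool) \<Rightarrow> 'a \<Rightarrow> (nat \<Rightarrow> 'a) set \<Rightarrow> 'a \<Rightarrow> int" where
  "busemann E v \<omega> x =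
     int (gdist E x (confluent \<omega> x v)) - int (gdist E v (confluent \<omega> x v))"

definition predecessor :: "('a \<Rightarrow> 'a \<Rightarrow> bool) \<Rightarrow> 'a \<Rightarrow> (nat \<Rightarrow> 'a) set \<Rightarrow> 'a \<Rightarrow> 'a" where
  "predecessor E v \<omega> x = (THE y. E x y \<and> busemann E v \<omega> y = busemann E v \<omega> x - 1)"

definition DL_verts :: "('a \<Rightarrow> 'a \<Rightarrow> bool) \<Rightarrow> 'a \<Rightarrow> (nat \<Rightarrow> 'a) set \<Rightarrow>
    ('b \<Rightarrow> 'b \<Rightarrow> bool) \<Rightarrow> 'b \<Rightarrow> (nat \<Rightarrow> 'b) set \<Rightarrow> ('a \<times> 'b) set" where
  "DL_verts E1 v1 \<omega>1 E2 v2 \<omega>2 =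
     {(x1, x2). busemann E1 v1 \<omega>1 x1 + busemann E2 v2 \<omega>2 x2 = 0}"

text \<open>
  The edges of the Diestel--Leader graph. The walk below is given by an explicit
  transition matrix and refers only to the vertex set of the graph.
\<close>

definition DL_adj :: "('a \<Rightarrow> 'a \<Rightarrow> bool) \<Rightarrow> 'a \<Rightarrow> (nat \<Rightarrow> 'a) set \<Rightarrow>
    ('b \<Rightarrow> 'b \<Rightarrow> bool) \<Rightarrow> 'b \<Rightarrow> (nat \<Rightarrow> 'b) set \<Rightarrow> 'a \<times> 'b \<Rightarrow> 'a \<times> 'b \<Rightarrow> bool" where
  "DL_adj E1 v1 \<omega>1 E2 v2 \<omega>2 x y \<longleftrightarrow>
     x \<in> DL_verts E1 v1 \<omega>1 E2 v2 \<omega>2 \<and> y \<in> DL_verts E1 v1 \<omega>1 E2 v2 \<omega>2 \<and>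
     E1 (fst x) (fst y) \<and> E2 (snd x) (snd y)"

definition DL_walk :: "nat \<Rightarrow> nat \<Rightarrow> real \<Rightarrow> ('a \<Rightarrow> 'a \<Rightarrow> bool) \<Rightarrow> 'a \<Rightarrow> (nat \<Rightarrow> 'a) set \<Rightarrow>
    ('b \<Rightarrow> 'b \<Rightarrow> bool) \<Rightarrow> 'b \<Rightarrow> (nat \<Rightarrow> 'b) set \<Rightarrow> 'a \<times> 'b \<Rightarrow> 'a \<times> 'b \<Rightarrow> real" where
  "DL_walk q r \<alpha> E1 v1 \<omega>1 E2 v2 \<omega>2 = (\<lambda>(x1, x2) (y1, y2).
     if predecessor E1 v1 \<omega>1 y1 = x1 \<and> y2 = predecessor E2 v2 \<omega>2 x2 then \<alpha> / real q
     else if y1 = predecessor E1 v1 \<omega>1 x1 \<and> predecessor E2 v2 \<omega>2 y2 = x2 then (1 - \<alpha>) / real r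
     else 0)"

definition proj1_walk :: "nat \<Rightarrow> real \<Rightarrow> ('a \<Rightarrow> 'a \<Rightarrow> bool) \<Rightarrow> 'a \<Rightarrow> (nat \<Rightarrow> 'a) set \<Rightarrow>
    'a \<Rightarrow> 'a \<Rightarrow> real" where
  "proj1_walk q \<alpha> E v \<omega> x y =
     (if predecessor E v \<omega> y = x then \<alpha> / real q
      else if y = predecessor E v \<omega> x then 1 - \<alpha>
      else 0)"

definition proj2_walk :: "nat \<Rightarrow> real \<Rightarrow> ('b \<Rightarrow> 'b \<Rightarrow> bool) \<Rightarrow> 'b \<Rightarrow> (nat \<Rightarrow> 'b) set \<Rightarrow>
    'b \<Rightarrow> 'b \<Rightarrow> real" where
  "proj2_walk r \<alpha> E v \<omega> x y =
     (if y = predecessor E v \<omega> x then \<alpha>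
      else if predecessor E v \<omega> y = x then (1 - \<alpha>) / real r
      else 0)"

definition harmonic_on :: "'a set \<Rightarrow> ('a \<Rightarrow> 'a \<Rightarrow> real) \<Rightarrow> ('a \<Rightarrow> real) \<Rightarrow> bool" where
  "harmonic_on X R h \<longleftrightarrow> (\<forall>x\<in>X. ((\<lambda>y. R x y * h y) has_sum h x) X)"

end

theory Submission
  imports Defs "HOL-Analysis.Function_Topology"
begin

text \<open>
  Let \<open>a1\<close>, \<open>a2\<close> be the \<open>n\<close>-th ancestors of two fixed vertices on opposite levels. The pairs of
  descendants of \<open>a1\<close> and \<open>a2\<close> form a finite tetrahedron in the Diestel--Leader graph, whose boundary
  consists of one edge on which the first coordinate is \<open>a1\<close> and one on which the second is \<open>a2\<close>.
  On each tree, solve the Dirichlet problem for the projected walk between the apex, with value \<open>0\<close>,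
  and the \<open>2n\<close>-th generation below it, with the values of \<open>h\<close> on the corresponding edge. The sum of
  the two non-negative solutions is harmonic inside the tetrahedron and agrees with \<open>h\<close> on its
  boundary, so by the maximum principle it equals \<open>h\<close>. The solutions are dominated by \<open>h\<close>, hence
  lie in a product of compact intervals, and any cluster point as \<open>n\<close> tends to infinity yields the
  global decomposition.
\<close>

section \<open>Distances in trees\<close>

text \<open>Loops are cut on the way: when the new endpoint already lies on the path, the path is
  truncated there.\<close>

lemma rtranclp_distinct_path:
  assumes "R\<^sup>*\<^sup>* x y"
  shows "\<exists>xs. xs \<noteq> [] \<and> hd xs = x \<and> last xs = y \<and> distinct xs \<and> successively R xs"
  using assms
proof (induction rule: rtranclp_induct)
  case base
  show ?case by (rule exI[of _ "[x]"]) simp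
next
  case (step y z)
  then obtain xs where xs: "xs \<noteq> []" "hd xs = x" "last xs = y" "distinct xs" "successively R xs"
    by blast
  show ?case
  proof (cases "z \<in> set xs")
    case True
    then obtain as bs where "xs = (as @ [z]) @ bs" by (auto dest: split_list)
    then have "as @ [z] \<noteq> [] \<and> hd (as @ [z]) = x \<and> last (as @ [z]) = z \<and> distinct (as @ [z]) \<and>
        successively R (as @ [z])"
      using xs by (cases as) (auto simp: successively_append_iff simp del: append.simps append_assoc)
    then show ?thesis by blast
  next
    case False
    then have "xs @ [z] \<noteq> [] \<and> hd (xs @ [z]) = x \<and> last (xs @ [z]) = z \<and> distinct (xs @ [z]) \<and>
        successively R (xs @ [z])"
      using xs step.hyps by (auto simp: successively_append_iff)
    then show ?thesis by blast
  qed
qed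

text \<open>A path from \<open>y\<close> to \<open>z\<close> that avoids \<open>x\<close> closes up
  to a cycle once \<open>x\<close> is put in front of it. All later uses of acyclicity go through
  this lemma.\<close>

lemma acyclic_neighbours_eq:
  assumes "symp E" and "\<nexists>xs. is_cycle E xs" and "E x y" and "E x z"
    and "(\<lambda>a b. E a b \<and> a \<noteq> x \<and> b \<noteq> x)\<^sup>*\<^sup>* y z" and "y \<noteq> x"
  shows "y = z"
proof (rule ccontr)
  assume "y \<noteq> z"
  obtain xs where xs: "xs \<noteq> []" "hd xs = y" "last xs = z" "distinct xs"
      "successively (\<lambda>a b. E a b \<and> a \<noteq> x \<and> b \<noteq> x) xs"
    using rtranclp_distinct_path[OF assms(5)] by blast
  \<comment> \<open>Since \<open>y\<close> and \<open>z\<close> differ, the path has two vertices at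
    least; with \<open>x\<close> in front the list reaches the length 3 required of a cycle.\<close>
  obtain w ws where ws: "xs = y # w # ws"
    using xs \<open>y \<noteq> z\<close> by (cases xs; cases "tl xs") auto
  have "successively E xs"
    using xs(5) by (rule successively_mono) simp
  moreover have "x \<notin> set xs"
  proof -
    have "successively (\<lambda>a b. E a b \<and> a \<noteq> x \<and> b \<noteq> x) ys \<Longrightarrow> ys \<noteq> [] \<Longrightarrow> hd ys \<noteq> x \<Longrightarrow> x \<notin> set ys" for ys
      by (induction ys rule: induct_list012) auto
    then show ?thesis using xs assms(6) by blast
  qed
  moreover have "E z x" using assms(1,4) by (auto dest: sympD)
  ultimately have "is_cycle E (x # xs)"
    using xs assms(3) ws unfolding is_cycle_def by auto
  then show False using assms(2) by blast
qed

context
  fixes E :: "'a \<Rightarrow> 'a \<Rightarrow> bool"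
  assumes tree: "is_tree E"
begin

lemma tree_sym: "E x y \<Longrightarrow> E y x"
  using tree by (auto simp: is_tree_def simple_graph_def dest: sympD)

lemma tree_irrefl: "\<not> E x x"
  using tree by (auto simp: is_tree_def simple_graph_def irreflp_def)

lemma gdist_relpow: "(E ^^ gdist E x y) x y"
proof -
  have "E\<^sup>*\<^sup>* x y" using tree by (simp add: is_tree_def connected_graph_def)
  then obtain n where "(E ^^ n) x y" by (auto simp: rtranclp_power)
  then show ?thesis unfolding gdist_def by (rule LeastI)
qed

lemma gdist_le: "(E ^^ n) x y \<Longrightarrow> gdist E x y \<le> n"
  unfolding gdist_def by (rule Least_le)

lemma gdist_self [simp]: "gdist E x x = 0"
  using gdist_le[of 0 x x] by simp

lemma gdist_eq_0D: "gdist E x y = 0 \<Longrightarrow> x = y"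
  using gdist_relpow[of x y] by simp

lemma gdist_step_le:
  assumes "E x y"
  shows "gdist E x z \<le> Suc (gdist E y z)"
  using assms gdist_relpow[of y z] by (intro gdist_le) (rule relpowp_Suc_I2)

lemma gdist_step_le':
  assumes "E x y"
  shows "gdist E y z \<le> Suc (gdist E x z)"
  using gdist_step_le[OF tree_sym[OF assms]] .

lemma gdist_closer_neighbour:
  assumes "x \<noteq> z"
  obtains y where "E x y" "gdist E x z = Suc (gdist E y z)"
proof -
  obtain n where n: "gdist E x z = Suc n"
    using assms gdist_eq_0D by (cases "gdist E x z") auto
  then obtain y where y: "E x y" "(E ^^ n) y z"
    using gdist_relpow[of x z] by (metis relpowp_Suc_E2)
  have "gdist E y z \<le> n" using y by (simp add: gdist_le)
  then show ?thesis
    using that y(1) n gdist_step_le[OF y(1), of z] by auto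
qed

text \<open>Descend from \<open>y\<close> to \<open>z\<close> through ever closer neighbours. From
  the first step on, every vertex is strictly closer to \<open>z\<close> than \<open>x\<close> is,
  so \<open>x\<close> is never met.\<close>

lemma gdist_le_avoids:
  assumes "y \<noteq> x" and "gdist E y z \<le> gdist E x z"
  shows "(\<lambda>a b. E a b \<and> a \<noteq> x \<and> b \<noteq> x)\<^sup>*\<^sup>* y z"
  using assms
proof (induction "gdist E y z" arbitrary: y)
  case 0
  then show ?case using gdist_eq_0D[of y z] by simp
next
  case (Suc n)
  then have "y \<noteq> z" by auto
  then obtain y' where y': "E y y'" "gdist E y z = Suc (gdist E y' z)"
    by (rule gdist_closer_neighbour)
  then have "y' \<noteq> x" using Suc by auto
  then have "(\<lambda>a b. E a b \<and> a \<noteq> x \<and> b \<noteq> x)\<^sup>*\<^sup>* y' z"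
    using Suc y' by auto
  then show ?case
    using y' \<open>y' \<noteq> x\<close> Suc.prems by (metis (mono_tags, lifting) converse_rtranclp_into_rtranclp)
qed

text \<open>Both neighbours reach \<open>z\<close> without passing through \<open>x\<close>, hence
  reach each other that way. The weak inequalities also cover a neighbour at equal distance, which
  is what excludes that case in the next lemma.\<close>

lemma closer_neighbour_unique:
  assumes "E x y" "E x y'" and "gdist E y z \<le> gdist E x z" "gdist E y' z \<le> gdist E x z"
  shows "y = y'"
proof -
  let ?R = "\<lambda>a b. E a b \<and> a \<noteq> x \<and> b \<noteq> x"
  have ne: "y \<noteq> x" "y' \<noteq> x" using assms tree_irrefl by auto
  have "symp ?R" using tree_sym by (auto intro!: sympI)
  then have "symp ?R\<^sup>*\<^sup>*" by (rule symp_rtranclp)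
  then have "?R\<^sup>*\<^sup>* y y'"
    using gdist_le_avoids[OF ne(1) assms(3)] gdist_le_avoids[OF ne(2) assms(4)]
    by (metis (no_types, lifting) rtranclp_trans sympD)
  then show ?thesis
    using acyclic_neighbours_eq[of E x y y'] assms(1,2) ne(1) tree
    by (auto simp: is_tree_def simple_graph_def)
qed

lemma gdist_neighbour_cases:
  assumes "E x y" and "x \<noteq> z"
  shows "gdist E y z = Suc (gdist E x z) \<or> gdist E x z = Suc (gdist E y z)"
proof (cases "gdist E y z \<le> gdist E x z")
  case True
  obtain y' where y': "E x y'" "gdist E x z = Suc (gdist E y' z)"
    using assms(2) by (rule gdist_closer_neighbour)
  then have "y = y'" using closer_neighbour_unique[OF assms(1) y'(1), of z] True by simp
  then show ?thesis using y' by simp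
next
  case False
  then show ?thesis using gdist_step_le'[OF assms(1), of z] by simp
qed

text \<open>The triangle inequality, arranged so that symmetry of the distance is not presupposed;
  symmetry then follows by taking \<open>z\<close> equal to \<open>x\<close>.\<close>

lemma gdist_shift: "gdist E y z \<le> gdist E x y + gdist E x z"
proof -
  have "(E ^^ n) x y \<Longrightarrow> gdist E y z \<le> n + gdist E x z" for n
  proof (induction n arbitrary: y)
    case (Suc n)
    then obtain w where w: "(E ^^ n) x w" "E w y" by auto
    show ?case using Suc.IH[OF w(1)] gdist_step_le'[OF w(2), of z] by simp
  qed simp
  then show ?thesis using gdist_relpow by blast
qed

lemma gdist_commute: "gdist E x y = gdist E y x"
  using gdist_shift[of y x x] gdist_shift[of x y y] by simp

end

section \<open>The horofunction of an end\<close>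

locale tree_with_ray =
  fixes E :: "'a \<Rightarrow> 'a \<Rightarrow> bool" and q :: nat and \<rho> :: "nat \<Rightarrow> 'a"
  assumes homogeneous: "homogeneous_tree q E" and ray: "\<rho> \<in> geodesic_rays E"
begin

lemma is_tree: "is_tree E"
  using homogeneous by (simp add: homogeneous_tree_def)

lemma finite_neighbours: "finite {y. E x y}"
proof -
  have "card {y. E x y} = q + 1"
    using homogeneous by (simp add: homogeneous_tree_def)
  then show ?thesis by (intro card_ge_0_finite) simp
qed

lemma gdist_ray: "int (gdist E (\<rho> m) (\<rho> n)) = \<bar>int m - int n\<bar>"
  using ray by (simp add: geodesic_rays_def)

text \<open>The description is proper: the sequence is eventually constant.\<close>

definition horo :: "'a \<Rightarrow> int" where
  "horo x = (THE k. \<forall>\<^sub>F n in sequentially. int (gdist E x (\<rho> n)) - int n = k)"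

lemma gdist_ray_antimono:
  assumes "m \<le> n"
  shows "int (gdist E x (\<rho> n)) - int n \<le> int (gdist E x (\<rho> m)) - int m"
proof -
  have "gdist E (\<rho> n) x \<le> gdist E (\<rho> m) (\<rho> n) + gdist E (\<rho> m) x"
    by (rule gdist_shift[OF is_tree])
  moreover have "int (gdist E (\<rho> m) (\<rho> n)) = int n - int m"
    using assms by (simp add: gdist_ray)
  ultimately show ?thesis
    using gdist_commute[OF is_tree, of x] by simp
qed

text \<open>The integer sequence is non-increasing by the triangle inequality and bounded below by
  \<open>- gdist E x (\<rho> 0)\<close>, so it stabilises.\<close>

lemma eventually_horo: "\<forall>\<^sub>F n in sequentially. int (gdist E x (\<rho> n)) - int n = horo x"
proof -
  define f where "f n = int (gdist E x (\<rho> n)) - int n" for n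
  let ?C = "int (gdist E x (\<rho> 0))"
  have anti: "f n \<le> f m" if "m \<le> n" for m n
    using gdist_ray_antimono[OF that] by (simp add: f_def)
  have lower: "f n \<ge> - ?C" for n
  proof -
    have "gdist E (\<rho> 0) (\<rho> n) \<le> gdist E x (\<rho> 0) + gdist E x (\<rho> n)"
      by (rule gdist_shift[OF is_tree])
    moreover have "int (gdist E (\<rho> 0) (\<rho> n)) = int n"
      by (simp add: gdist_ray)
    ultimately show ?thesis by (simp add: f_def)
  qed
  \<comment> \<open>Shifting by \<open>?C\<close> makes all values non-negative, so a minimum exists
    among natural numbers; by monotonicity the sequence keeps it from \<open>n0\<close> on.\<close>
  obtain n0 where n0: "\<And>n. nat (f n0 + ?C) \<le> nat (f n + ?C)"
    using ex_has_least_nat[of "\<lambda>_. True" 0 "\<lambda>n. nat (f n + ?C)"] by auto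
  have "f n = f n0" if "n \<ge> n0" for n
    using n0[of n] lower[of n] anti[OF that] by simp
  then have ev: "\<forall>\<^sub>F n in sequentially. f n = f n0"
    by (rule eventually_sequentiallyI)
  have "horo x = f n0"
    unfolding horo_def
  proof (rule the_equality)
    show "\<forall>\<^sub>F n in sequentially. int (gdist E x (\<rho> n)) - int n = f n0"
      using ev by (simp add: f_def)
  next
    fix k assume "\<forall>\<^sub>F n in sequentially. int (gdist E x (\<rho> n)) - int n = k"
    then have "\<forall>\<^sub>F n in sequentially. k = f n0"
      using ev by eventually_elim (simp add: f_def)
    then show "k = f n0" by simp
  qed
  then show ?thesis using ev by (simp add: f_def)
qed

lemma horo_le: "horo x \<le> int (gdist E x (\<rho> n)) - int n"
proof -
  obtain N where "\<And>m. m \<ge> N \<Longrightarrow> int (gdist E x (\<rho> m)) - int m = horo x"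
    using eventually_horo[of x] unfolding eventually_sequentially by blast
  then have "int (gdist E x (\<rho> (max N n))) - int (max N n) = horo x" by simp
  then show ?thesis using gdist_ray_antimono[of n "max N n" x] by linarith
qed

lemma horo_ray: "horo (\<rho> n) = - int n"
proof -
  have "\<forall>\<^sub>F m in sequentially. horo (\<rho> n) = - int n"
    using eventually_horo[of "\<rho> n"] eventually_ge_at_top[of n]
    by eventually_elim (simp add: gdist_ray)
  then show ?thesis by simp
qed

lemma eventually_not_ray: "\<forall>\<^sub>F n in sequentially. x \<noteq> \<rho> n"
  using eventually_gt_at_top[of "nat (- horo x)"]
proof eventually_elim
  case (elim n)
  then show ?case using horo_ray[of n] by auto
qed

text \<open>For large \<open>n\<close> both values are read off from distances to
  \<open>\<rho> n\<close>, and these differ by exactly one. The claim does not mention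
  \<open>n\<close>, so holding eventually it holds outright; the next lemma uses the same
  device.\<close>

lemma horo_neighbour:
  assumes "E x y"
  shows "horo y = horo x - 1 \<or> horo y = horo x + 1"
proof -
  have "\<forall>\<^sub>F n in sequentially. horo y = horo x - 1 \<or> horo y = horo x + 1"
    using eventually_not_ray[of x] eventually_horo[of x] eventually_horo[of y]
  proof eventually_elim
    case (elim n)
    then show ?case using gdist_neighbour_cases[OF is_tree assms elim(1)] by linarith
  qed
  then show ?thesis by simp
qed

text \<open>As there are finitely many neighbours, one \<open>n\<close> computes \<open>horo\<close>
  at all of them simultaneously. The predecessor is then the unique neighbour closer to
  \<open>\<rho> n\<close>.\<close>

lemma ex1_horo_predecessor: "\<exists>!y. E x y \<and> horo y = horo x - 1"
proof -
  have "\<forall>\<^sub>F n in sequentially. \<forall>y\<in>{y. E x y}. int (gdist E y (\<rho> n)) - int n = horo y"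
    using eventually_horo by (intro eventually_ball_finite finite_neighbours) auto
  then have "\<forall>\<^sub>F n in sequentially. \<exists>!y. E x y \<and> horo y = horo x - 1"
    using eventually_not_ray[of x] eventually_horo[of x]
  proof eventually_elim
    case (elim n)
    obtain y where y: "E x y" "gdist E x (\<rho> n) = Suc (gdist E y (\<rho> n))"
      using elim(2) by (rule gdist_closer_neighbour[OF is_tree])
    have "horo y = horo x - 1"
      using elim y by force
    moreover have "z = y" if "E x z" "horo z = horo x - 1" for z
    proof -
      have "int (gdist E z (\<rho> n)) - int n = horo z" using elim(1) that by simp
      then have "gdist E z (\<rho> n) \<le> gdist E x (\<rho> n)" using elim(3) that by simp
      then show ?thesis
        using closer_neighbour_unique[OF is_tree that(1) y(1), of "\<rho> n"] y(2) by simp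
    qed
    ultimately show ?case using y(1) by blast
  qed
  then show ?thesis by simp
qed

section \<open>Ancestor lines as geodesic rays\<close>

definition pred where "pred x = (THE y. E x y \<and> horo y = horo x - 1)"

lemma pred_adj: "E x (pred x)" and horo_pred: "horo (pred x) = horo x - 1"
  using theI'[OF ex1_horo_predecessor[of x]] by (simp_all add: pred_def)

text \<open>An inequality suffices because \<open>horo\<close> changes by exactly one along an
  edge.\<close>

lemma pred_eqI: "E x y \<Longrightarrow> horo y \<le> horo x - 1 \<Longrightarrow> pred x = y"
  using ex1_horo_predecessor[of x] pred_adj[of x] horo_pred[of x] horo_neighbour[of x y]
  by (smt (verit))

lemma horo_funpow_pred: "horo ((pred ^^ n) x) = horo x - int n"
  by (induction n) (simp_all add: horo_pred)

lemma relpow_funpow_pred: "(E ^^ n) x ((pred ^^ n) x)"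
  by (induction n) (auto intro: pred_adj)

lemma horo_diff_le_gdist: "horo x - horo y \<le> int (gdist E x y)"
proof -
  have "(E ^^ n) x y \<Longrightarrow> horo x - horo y \<le> int n" for n
  proof (induction n arbitrary: y)
    case (Suc n)
    then obtain w where w: "(E ^^ n) x w" "E w y" by auto
    show ?case using Suc.IH[OF w(1)] horo_neighbour[OF w(2)] by auto
  qed simp
  then show ?thesis using gdist_relpow[OF is_tree] by blast
qed

text \<open>The ancestor line is a path of length \<open>n\<close>, and none is shorter, since
  \<open>horo\<close> drops by \<open>n\<close> and is 1-Lipschitz.\<close>

lemma gdist_funpow_pred: "gdist E x ((pred ^^ n) x) = n"
  using horo_diff_le_gdist[of x "(pred ^^ n) x"] gdist_le[OF is_tree relpow_funpow_pred[of n x]]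
  by (simp add: horo_funpow_pred)

lemma funpow_pred_diff: "m \<le> n \<Longrightarrow> (pred ^^ n) x = (pred ^^ (n - m)) ((pred ^^ m) x)"
  using funpow_add[of "n - m" m pred] by simp

lemma pred_ray_geodesic: "(\<lambda>n. (pred ^^ n) x) \<in> geodesic_rays E"
proof -
  have *: "gdist E ((pred ^^ m) x) ((pred ^^ n) x) = n - m" if "m \<le> n" for m n
    using gdist_funpow_pred[of "(pred ^^ m) x" "n - m"] funpow_pred_diff[OF that, of x] by simp
  have "int (gdist E ((pred ^^ m) x) ((pred ^^ n) x)) = \<bar>int m - int n\<bar>" for m n
  proof (cases "m \<le> n")
    case True
    then show ?thesis using *[OF True] by simp
  next
    case False
    then show ?thesis using *[of n m] by (subst gdist_commute[OF is_tree]) simp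
  qed
  then show ?thesis by (simp add: geodesic_rays_def)
qed

text \<open>If \<open>\<rho> n\<close> attains the value \<open>horo x\<close>, the first step of a
  geodesic towards \<open>\<rho> n\<close> must lower \<open>horo\<close>. So that step leads to
  \<open>pred x\<close>, and \<open>\<rho> n\<close> attains the value there as well.\<close>

lemma funpow_pred_reaches_ray:
  "int (gdist E x (\<rho> n)) = horo x + int n \<Longrightarrow> (pred ^^ gdist E x (\<rho> n)) x = \<rho> n"
proof (induction "gdist E x (\<rho> n)" arbitrary: x)
  case 0
  then show ?case using gdist_eq_0D[OF is_tree, of x "\<rho> n"] by simp
next
  case (Suc k)
  then have "x \<noteq> \<rho> n" using gdist_self[OF is_tree] by auto
  then obtain y where y: "E x y" "gdist E x (\<rho> n) = Suc (gdist E y (\<rho> n))"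
    by (rule gdist_closer_neighbour[OF is_tree])
  have "horo y \<le> horo x - 1"
    using horo_le[of y n] y Suc.prems by simp
  then have p: "pred x = y" using pred_eqI y by blast
  have "(pred ^^ gdist E y (\<rho> n)) y = \<rho> n"
    using Suc.hyps(1)[of y] Suc.hyps(2) Suc.prems y(2) p horo_pred[of x] by simp
  then show ?case using p y(2) by (simp add: funpow_Suc_right del: funpow.simps)
qed

lemma funpow_pred_meets_ray: "\<exists>i j. (pred ^^ i) x = \<rho> j"
proof -
  obtain n where "int (gdist E x (\<rho> n)) - int n = horo x"
    using eventually_happens'[OF _ eventually_horo[of x]] by auto
  then show ?thesis using funpow_pred_reaches_ray[of x n] by auto
qed

text \<open>Take a common vertex far out on both rays. One step along \<open>\<sigma>\<close> comes
  closer to it by one, hence lowers \<open>horo\<close> by at least one, so the step goes to the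
  predecessor.\<close>

lemma pred_of_ray:
  assumes "\<sigma> \<in> geodesic_rays E" and "infinite (range \<sigma> \<inter> range \<rho>)"
  shows "\<sigma> (Suc m) = pred (\<sigma> m)"
proof -
  have d: "int (gdist E (\<sigma> i) (\<sigma> j)) = \<bar>int i - int j\<bar>" for i j
    using assms(1) by (simp add: geodesic_rays_def)
  obtain N where N: "\<And>n. n \<ge> N \<Longrightarrow> int (gdist E (\<sigma> m) (\<rho> n)) - int n = horo (\<sigma> m)"
    using eventually_horo[of "\<sigma> m"] unfolding eventually_sequentially by blast
  \<comment> \<open>Only finitely many vertices are discarded, so there remains a common vertex
    beyond index \<open>m\<close> on \<open>\<sigma>\<close> and not before index \<open>N\<close>
    on \<open>\<rho>\<close>.\<close>
  have "infinite ((range \<sigma> \<inter> range \<rho>) - (\<sigma> ` {..m} \<union> \<rho> ` {..<N}))"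
    using assms(2) by (intro Diff_infinite_finite) auto
  then obtain z where "z \<in> (range \<sigma> \<inter> range \<rho>) - (\<sigma> ` {..m} \<union> \<rho> ` {..<N})"
    by (metis ex_in_conv finite.emptyI)
  then obtain j n where z: "z = \<sigma> j" "z = \<rho> n" "z \<notin> \<sigma> ` {..m}" "z \<notin> \<rho> ` {..<N}"
    by blast
  have "j > m" using z by (metis atMost_iff imageI not_le)
  moreover have "n \<ge> N" using z by (metis imageI lessThan_iff not_le)
  ultimately have jn: "z = \<sigma> j" "z = \<rho> n" "j > m" "n \<ge> N" using z by simp_all
  have "horo (\<sigma> (Suc m)) \<le> int (gdist E (\<sigma> (Suc m)) (\<sigma> j)) - int n"
    using horo_le[of "\<sigma> (Suc m)" n] jn by simp
  also have "\<dots> = int (gdist E (\<sigma> m) (\<sigma> j)) - int n - 1"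
    using jn(3) by (simp add: d)
  also have "\<dots> = horo (\<sigma> m) - 1"
    using N[of n] jn by simp
  finally have "horo (\<sigma> (Suc m)) \<le> horo (\<sigma> m) - 1" .
  moreover have "E (\<sigma> m) (\<sigma> (Suc m))"
  proof -
    have "gdist E (\<sigma> m) (\<sigma> (Suc m)) = 1"
      using d[of m "Suc m"] by simp
    then show ?thesis using gdist_relpow[OF is_tree, of "\<sigma> m" "\<sigma> (Suc m)"] by auto
  qed
  ultimately show ?thesis using pred_eqI by metis
qed

section \<open>Confluent, Busemann function and predecessor in terms of ancestor lines\<close>

definition "end_of_ray = ray_equiv E `` {\<rho>}"

lemma inj_ray:
  assumes "\<sigma> \<in> geodesic_rays E"
  shows "inj \<sigma>"
proof (rule injI)
  fix m n assume "\<sigma> m = \<sigma> n"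
  moreover have "int (gdist E (\<sigma> m) (\<sigma> n)) = \<bar>int m - int n\<bar>"
    using assms by (simp add: geodesic_rays_def)
  ultimately show "m = n" by (simp add: gdist_self[OF is_tree])
qed

text \<open>Equivalent rays have infinitely many common vertices, so \<open>pred_of_ray\<close>
  applies at every step.\<close>

lemma ray_eq_funpow_pred:
  assumes "\<sigma> \<in> end_of_ray"
  shows "\<sigma> n = (pred ^^ n) (\<sigma> 0)"
proof -
  have g: "\<sigma> \<in> geodesic_rays E" and fin: "finite ((range \<rho> - range \<sigma>) \<union> (range \<sigma> - range \<rho>))"
    using assms by (auto simp: end_of_ray_def ray_equiv_def)
  have "infinite (range \<sigma>)" using inj_ray[OF g] by (rule range_inj_infinite)
  then have "infinite (range \<sigma> - (range \<sigma> - range \<rho>))"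
    using fin by (intro Diff_infinite_finite) auto
  moreover have "range \<sigma> - (range \<sigma> - range \<rho>) = range \<sigma> \<inter> range \<rho>" by auto
  ultimately have inf: "infinite (range \<sigma> \<inter> range \<rho>)" by simp
  show ?thesis by (induction n) (simp_all add: pred_of_ray[OF g inf])
qed

lemma pred_ray: "pred (\<rho> n) = \<rho> (Suc n)"
  using pred_of_ray[OF ray] range_inj_infinite[OF inj_ray[OF ray]] by simp

lemma funpow_pred_ray: "(pred ^^ n) (\<rho> m) = \<rho> (n + m)"
  by (induction n) (simp_all add: pred_ray)

text \<open>Once the ancestor line hits the ray, the two run together; only finite initial segments
  can differ.\<close>

lemma pred_ray_in_end: "(\<lambda>n. (pred ^^ n) x) \<in> end_of_ray"
proof -
  let ?\<sigma> = "\<lambda>n. (pred ^^ n) x"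
  obtain i j where ij: "(pred ^^ i) x = \<rho> j" using funpow_pred_meets_ray by blast
  have *: "(pred ^^ (k + i)) x = \<rho> (k + j)" for k
    using ij by (simp add: funpow_add funpow_pred_ray)
  have "?\<sigma> n \<in> range \<rho>" if "n \<ge> i" for n
    using *[of "n - i"] that by auto
  then have "range ?\<sigma> - range \<rho> \<subseteq> ?\<sigma> ` {..<i}" by (force simp: not_le[symmetric])
  moreover have "\<rho> n \<in> range ?\<sigma>" if "n \<ge> j" for n
    using *[of "n - j"] that by (metis le_add_diff_inverse2 rangeI)
  then have "range \<rho> - range ?\<sigma> \<subseteq> \<rho> ` {..<j}" by (force simp: not_le[symmetric])
  ultimately have "finite ((range \<rho> - range ?\<sigma>) \<union> (range ?\<sigma> - range \<rho>))"
    by (meson finite_UnI finite_imageI finite_lessThan finite_subset)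
  then show ?thesis
    using pred_ray_geodesic ray by (simp add: end_of_ray_def ray_equiv_def)
qed

lemma ray_to_end: "ray_to x end_of_ray = (\<lambda>n. (pred ^^ n) x)"
  unfolding ray_to_def
proof (rule the_equality)
  show "(\<lambda>n. (pred ^^ n) x) \<in> end_of_ray \<and> (pred ^^ 0) x = x"
    using pred_ray_in_end by simp
next
  fix \<sigma> assume "\<sigma> \<in> end_of_ray \<and> \<sigma> 0 = x"
  then show "\<sigma> = (\<lambda>n. (pred ^^ n) x)" using ray_eq_funpow_pred by blast
qed

lemma funpow_pred_confluent: "\<exists>i j. (pred ^^ i) x = (pred ^^ j) y"
proof -
  obtain i j i' j' where "(pred ^^ i) x = \<rho> j" "(pred ^^ i') y = \<rho> j'"
    using funpow_pred_meets_ray by meson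
  then have "(pred ^^ (j' + i)) x = \<rho> (j' + j)" "(pred ^^ (j + i')) y = \<rho> (j + j')"
    by (simp_all add: funpow_add funpow_pred_ray)
  then show ?thesis by (metis add.commute)
qed

lemma confluent_end:
  obtains i j where "confluent end_of_ray x y = (pred ^^ i) x"
    and "confluent end_of_ray x y = (pred ^^ j) y"
proof -
  define R where "R x = range (\<lambda>n. (pred ^^ n) x)" for x
  \<comment> \<open>The confluent is the first ancestor of \<open>x\<close> that is also an ancestor
    of \<open>y\<close>.\<close>
  define i where "i = (LEAST i. (pred ^^ i) x \<in> R y)"
  define b where "b = (pred ^^ i) x"
  have "\<exists>i. (pred ^^ i) x \<in> R y"
    using funpow_pred_confluent[of x y] by (auto simp: R_def)
  then have "b \<in> R y" unfolding b_def i_def by (rule LeastI_ex)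
  then obtain j where j: "b = (pred ^^ j) y" by (auto simp: R_def)
  have "R b \<subseteq> R x \<inter> R y"
  proof
    fix z assume "z \<in> R b"
    then obtain n where "z = (pred ^^ n) b" by (auto simp: R_def)
    then have "z = (pred ^^ (n + i)) x" "z = (pred ^^ (n + j)) y"
      using j by (auto simp: b_def funpow_add)
    then show "z \<in> R x \<inter> R y" unfolding R_def by blast
  qed
  moreover have "R x \<inter> R y \<subseteq> R b"
  proof
    fix z assume "z \<in> R x \<inter> R y"
    then obtain n where n: "z = (pred ^^ n) x" "(pred ^^ n) x \<in> R y" by (auto simp: R_def)
    then have "i \<le> n" by (simp add: i_def Least_le)
    then have "z = (pred ^^ (n - i)) b"
      using n funpow_pred_diff[of i n x] by (simp add: b_def)
    then show "z \<in> R b" by (auto simp: R_def)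
  qed
  ultimately have inter: "R x \<inter> R y = R b" by auto
  have "confluent end_of_ray x y = b"
    unfolding confluent_def ray_to_end R_def[symmetric]
  proof (rule the_equality)
    show "R x \<inter> R y = R b" by (rule inter)
  next
    \<comment> \<open>Two vertices with the same ancestor line are ancestors of each other, and
      \<open>horo\<close> forces both generation gaps to vanish.\<close>
    fix c assume "R x \<inter> R y = R c"
    then have eq: "R b = R c" using inter by simp
    have self: "a \<in> R a" for a
      unfolding R_def by (rule range_eqI[of _ _ 0]) simp
    obtain m where m: "b = (pred ^^ m) c" using self[of b] eq by (auto simp: R_def)
    obtain n where n: "c = (pred ^^ n) b" using self[of c] eq by (auto simp: R_def)
    have "horo b = horo c - int m" "horo c = horo b - int n"
      using horo_funpow_pred m n by metis+
    then have "m = 0" by linarith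
    then show "c = b" using m by simp
  qed
  then show ?thesis using that j by (auto simp: b_def)
qed

text \<open>If the confluent is the \<open>i\<close>-th ancestor of \<open>x\<close> and the
  \<open>j\<close>-th of \<open>v\<close>, both sides equal \<open>i - j\<close>.\<close>

lemma busemann_end: "busemann E v end_of_ray x = horo x - horo v"
proof -
  obtain i j where c: "confluent end_of_ray x v = (pred ^^ i) x"
      "confluent end_of_ray x v = (pred ^^ j) v"
    by (rule confluent_end)
  have "horo x - int i = horo v - int j"
    using c horo_funpow_pred by metis
  moreover have "gdist E x (confluent end_of_ray x v) = i"
    unfolding c(1) by (rule gdist_funpow_pred)
  moreover have "gdist E v (confluent end_of_ray x v) = j"
    unfolding c(2) by (rule gdist_funpow_pred)
  ultimately show ?thesis unfolding busemann_def by simp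
qed

text \<open>The Busemann function is \<open>horo\<close> up to an additive constant, and only level
  differences enter the definition.\<close>

lemma predecessor_end: "predecessor E v end_of_ray = pred"
  unfolding predecessor_def pred_def busemann_end by (simp add: algebra_simps)

text \<open>Each of the \<open>q + 1\<close> neighbours of \<open>x\<close> is either its
  predecessor or has \<open>x\<close> as predecessor, never both.\<close>

lemma card_successors: "card {y. pred y = x} = q"
proof -
  have "{y. E x y} = insert (pred x) {y. pred y = x}"
  proof (intro equalityI subsetI)
    fix y assume "y \<in> {y. E x y}"
    then have "E x y" "E y x" using tree_sym[OF is_tree] by auto
    then show "y \<in> insert (pred x) {y. pred y = x}"
      using horo_neighbour[of x y] pred_eqI[of x y] pred_eqI[of y x] by auto
  next
    fix y assume "y \<in> insert (pred x) {y. pred y = x}"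
    then show "y \<in> {y. E x y}"
      using pred_adj[of x] pred_adj[of y] tree_sym[OF is_tree] by auto
  qed
  moreover have "pred x \<notin> {y. pred y = x}"
    using horo_pred[of x] horo_pred[of "pred x"] by auto
  moreover have "card {y. E x y} = q + 1"
    using homogeneous by (simp add: homogeneous_tree_def)
  ultimately show ?thesis
    using finite_neighbours[of x] by simp
qed

end

section \<open>Dirichlet problems on trees\<close>

text \<open>Everything that the remaining argument uses of a tree with a reference end; edges, rays
  and distances are left behind.\<close>

locale horocyclic_tree =
  fixes p :: "'a \<Rightarrow> 'a" and b :: "'a \<Rightarrow> int" and q :: nat
  assumes level_pred: "b (p x) = b x - 1"
    and card_succ: "card {y. p y = x} = q"
    and q_pos: "q > 0"
    and common_ancestor: "\<exists>i j. (p ^^ i) x = (p ^^ j) y"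
begin

lemma finite_succ: "finite {y. p y = x}"
  using card_succ[of x] q_pos by (intro card_ge_0_finite) simp

lemma ex_succ: "\<exists>y. p y = x"
proof (rule ccontr)
  assume "\<nexists>y. p y = x"
  then have "{y. p y = x} = {}" by simp
  then show False using card_succ[of x] q_pos by simp
qed

lemma level_funpow: "b ((p ^^ n) x) = b x - int n"
  by (induction n) (simp_all add: level_pred)

lemma ex_level: "\<exists>x. b x = k"
proof -
  have up: "\<exists>y. b y = b x + int n" for n and x :: 'a
  proof (induction n)
    case (Suc n)
    then obtain y where y: "b y = b x + int n" by blast
    obtain z where "p z = y" using ex_succ by blast
    then have "b z = b x + int (Suc n)" using level_pred[of z] y by simp
    then show ?case by blast
  qed auto
  fix x :: 'a
  show ?thesis
  proof (cases "k \<le> b x")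
    case True
    then have "b ((p ^^ nat (b x - k)) x) = k" by (simp add: level_funpow)
    then show ?thesis by blast
  next
    case False
    then show ?thesis using up[of x "nat (k - b x)"] by simp
  qed
qed

lemma finite_descendants: "finite {x. (p ^^ n) x = a}"
proof (induction n arbitrary: a)
  case (Suc n)
  have "{x. (p ^^ Suc n) x = a} = (\<Union>y\<in>{y. p y = a}. {x. (p ^^ n) x = y})"
    by auto
  moreover have "finite (\<Union>y\<in>{y. p y = a}. {x. (p ^^ n) x = y})"
    by (intro finite_UN_I finite_succ Suc)
  ultimately show ?case by (simp only:)
qed simp

text \<open>Every vertex eventually lies strictly between the \<open>n\<close>-th ancestor of
  \<open>v\<close> and the \<open>2 * n\<close>-th generation below that ancestor, so the tetrahedra
  exhaust the graph.\<close>

lemma eventually_ancestor: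
  "\<forall>\<^sub>F n in sequentially. \<exists>k. 0 < k \<and> k < 2 * n \<and> (p ^^ k) x = (p ^^ n) v"
proof -
  obtain i j where ij: "(p ^^ i) x = (p ^^ j) v" using common_ancestor by blast
  show ?thesis
    using eventually_ge_at_top[of j] eventually_gt_at_top[of "nat \<bar>b x - b v\<bar>"]
  proof eventually_elim
    case (elim n)
    define k where "k = n - j + i"
    have "(p ^^ k) x = (p ^^ (n - j + j)) v"
      unfolding k_def funpow_add comp_apply ij ..
    then have k: "(p ^^ k) x = (p ^^ n) v" using elim by simp
    \<comment> \<open>Comparing levels, \<open>k\<close> equals \<open>n + b x - b v\<close>, which
      lies strictly between \<open>0\<close> and \<open>2 * n\<close> because \<open>n\<close>
      exceeds the level difference.\<close>
    have "b x - int k = b v - int n" using k level_funpow by metis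
    then have "0 < k" "k < 2 * n" using elim by linarith+
    then show ?case using k by blast
  qed
qed

text \<open>One step of a projected walk, with \<open>\<beta>\<close> the total probability of
  moving to a successor: \<open>\<alpha>\<close> on the first tree and \<open>1 - \<alpha>\<close>
  on the second.\<close>

definition avg :: "real \<Rightarrow> ('a \<Rightarrow> real) \<Rightarrow> 'a \<Rightarrow> real" where
  "avg \<beta> f x = \<beta> / real q * (\<Sum>y | p y = x. f y) + (1 - \<beta>) * f (p x)"

lemma avg_const: "avg \<beta> (\<lambda>_. c) x = c"
  using q_pos by (simp add: avg_def card_succ algebra_simps)

lemma avg_mono:
  assumes "0 \<le> \<beta>" "\<beta> \<le> 1" "\<And>y. f y \<le> g y"
  shows "avg \<beta> f x \<le> avg \<beta> g x"
proof -
  have "\<beta> / real q * (\<Sum>y | p y = x. f y) \<le> \<beta> / real q * (\<Sum>y | p y = x. g y)"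
    using assms(1) by (intro mult_left_mono sum_mono assms(3)) simp
  moreover have "(1 - \<beta>) * f (p x) \<le> (1 - \<beta>) * g (p x)"
    using assms(2) by (intro mult_left_mono assms(3)) simp
  ultimately show ?thesis by (simp add: avg_def)
qed

lemma avg_tendsto:
  assumes "\<And>y. (\<lambda>n. f n y) \<longlonglongrightarrow> g y"
  shows "(\<lambda>n. avg \<beta> (f n) x) \<longlonglongrightarrow> avg \<beta> g x"
proof -
  have "(\<lambda>n. \<Sum>y | p y = x. f n y) \<longlonglongrightarrow> (\<Sum>y | p y = x. g y)"
    by (rule tendsto_sum) (rule assms)
  then show ?thesis
    unfolding avg_def by (intro tendsto_add tendsto_mult_left assms)
qed

text \<open>Continuity for pointwise convergence; it turns harmonicity at a vertex into a closed
  condition, which survives passage to a cluster point.\<close>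

lemma continuous_on_avg: "continuous_on UNIV (\<lambda>f. avg \<beta> f x)"
  unfolding avg_def
  by (intro continuous_on_add continuous_on_mult_left continuous_on_sum
      continuous_on_product_coordinates)

text \<open>The solution is the limit of the monotone iteration started at \<open>0\<close>, so \<open>I\<close> may be infinite.\<close>

lemma dirichlet_problem:
  assumes \<beta>: "0 \<le> \<beta>" "\<beta> \<le> 1" and g: "\<And>x. 0 \<le> g x" "\<And>x. g x \<le> M"
  obtains u where "\<And>x. 0 \<le> u x" "\<And>x. x \<notin> I \<Longrightarrow> u x = g x" "\<And>x. x \<in> I \<Longrightarrow> u x = avg \<beta> u x"
proof -
  \<comment> \<open>Fixed points of \<open>A\<close> are exactly the functions that are harmonic on
    \<open>I\<close> and equal to \<open>g\<close> off \<open>I\<close>.\<close>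
  define A where "A f x = (if x \<in> I then avg \<beta> f x else g x)" for f x
  define f where "f n = (A ^^ n) (\<lambda>_. 0)" for n
  have f0: "f 0 = (\<lambda>_. 0)" and fSuc: "f (Suc n) = A (f n)" for n by (simp_all add: f_def)
  have A_mono: "A f1 x \<le> A f2 x" if "\<And>y. f1 y \<le> f2 y" for f1 f2 x
    using avg_mono[OF \<beta> that] by (simp add: A_def)
  have M: "0 \<le> M" using g order_trans by blast
  have nonneg: "0 \<le> f n x" for n x
  proof (induction n arbitrary: x)
    case (Suc n)
    show ?case
      using avg_mono[OF \<beta>, of "\<lambda>_. 0" "f n" x] Suc g(1) by (simp add: fSuc A_def avg_const)
  qed (simp add: f0)
  have bound: "f n x \<le> M" for n x
  proof (induction n arbitrary: x)
    case (Suc n)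
    show ?case
      using avg_mono[OF \<beta>, of "f n" "\<lambda>_. M" x] Suc g(2) by (simp add: fSuc A_def avg_const)
  qed (simp add: f0 M)
  have step: "f n x \<le> f (Suc n) x" for n x
  proof (induction n arbitrary: x)
    case 0
    show ?case using nonneg[of 1 x] by (simp add: f0)
  next
    case (Suc n)
    show ?case using A_mono[OF Suc] by (simp add: fSuc)
  qed
  have "\<exists>l. (\<lambda>n. f n x) \<longlonglongrightarrow> l" for x
  proof -
    have "incseq (\<lambda>n. f n x)" using step by (intro incseq_SucI)
    then show ?thesis using incseq_convergent bound by metis
  qed
  then obtain u where u: "\<And>x. (\<lambda>n. f n x) \<longlonglongrightarrow> u x" by metis
  have fix_u: "u x = A u x" for x
  proof (rule LIMSEQ_unique)
    show "(\<lambda>n. f (Suc n) x) \<longlonglongrightarrow> u x" using u by (rule LIMSEQ_Suc)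
    show "(\<lambda>n. f (Suc n) x) \<longlonglongrightarrow> A u x"
      unfolding fSuc A_def using avg_tendsto[of f u \<beta> x] u by simp
  qed
  show ?thesis
  proof
    show "0 \<le> u x" for x
      using u[of x] nonneg by (intro LIMSEQ_le_const) auto
    show "u x = g x" if "x \<notin> I" for x
      using fix_u[of x] that by (simp add: A_def)
    show "u x = avg \<beta> u x" if "x \<in> I" for x
      using fix_u[of x] that unfolding A_def by simp
  qed
qed

end

section \<open>Decomposition on tetrahedra\<close>

locale diestel_leader =
  T1: horocyclic_tree p1 b1 q + T2: horocyclic_tree p2 b2 r
  for p1 :: "'a \<Rightarrow> 'a" and b1 q and p2 :: "'b \<Rightarrow> 'b" and b2 r +
  fixes \<alpha> :: real
  assumes \<alpha>: "0 < \<alpha>" "\<alpha> < 1"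
begin

definition avg :: "('a \<times> 'b \<Rightarrow> real) \<Rightarrow> 'a \<Rightarrow> 'b \<Rightarrow> real" where
  "avg f x1 x2 = \<alpha> / real q * (\<Sum>y | p1 y = x1. f (y, p2 x2)) +
     (1 - \<alpha>) / real r * (\<Sum>y | p2 y = x2. f (p1 x1, y))"

lemma avg_diff: "avg (\<lambda>z. f z - g z) x1 x2 = avg f x1 x2 - avg g x1 x2"
  by (simp add: avg_def sum_subtractf algebra_simps)

text \<open>Each coordinate of the walk performs the projected walk, so functions of a single
  coordinate average separately. The parameter is \<open>1 - \<alpha>\<close> on the second tree
  since the coordinates move in opposite directions.\<close>

lemma avg_separated:
  "avg (\<lambda>(y1, y2). f y1 + g y2) x1 x2 = T1.avg \<alpha> f x1 + T2.avg (1 - \<alpha>) g x2"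
proof -
  have "(\<Sum>y | p1 y = x1. f y + g (p2 x2)) = (\<Sum>y | p1 y = x1. f y) + real q * g (p2 x2)"
    by (simp add: sum.distrib T1.card_succ)
  moreover have "(\<Sum>y | p2 y = x2. f (p1 x1) + g y) = real r * f (p1 x1) + (\<Sum>y | p2 y = x2. g y)"
    by (simp add: sum.distrib T2.card_succ)
  ultimately show ?thesis
    using T1.q_pos T2.q_pos by (simp add: avg_def T1.avg_def T2.avg_def distrib_left)
qed

text \<open>
  Whenever the level of \<open>a1\<close> plus that of \<open>a2\<close> is \<open>- N\<close>, the layers \<open>0, ..., N\<close> form the finite
  tetrahedron spanned by \<open>a1\<close> and \<open>a2\<close>; the walk can only leave it through layers \<open>0\<close> and \<open>N\<close>.
\<close>

definition layer :: "'a \<Rightarrow> 'b \<Rightarrow> nat \<Rightarrow> nat \<Rightarrow> ('a \<times> 'b) set" where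
  "layer a1 a2 N k = {(x1, x2). (p1 ^^ k) x1 = a1 \<and> (p2 ^^ (N - k)) x2 = a2}"

lemma layer_up:
  assumes "(x1, x2) \<in> layer a1 a2 N k" "k < N" "p1 y = x1"
  shows "(y, p2 x2) \<in> layer a1 a2 N (Suc k)"
proof -
  have "(p2 ^^ Suc (N - Suc k)) x2 = a2" using assms(1,2)
    by (simp add: layer_def Suc_diff_Suc del: funpow.simps)
  then show ?thesis
    using assms(1,3) by (simp add: layer_def funpow_Suc_right del: funpow.simps)
qed

lemma layer_down:
  assumes "(x1, x2) \<in> layer a1 a2 N k" "0 < k" "k \<le> N" "p2 y = x2"
  shows "(p1 x1, y) \<in> layer a1 a2 N (k - 1)"
proof -
  obtain j where k: "k = Suc j" using assms(2) by (cases k) auto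
  moreover have "N - j = Suc (N - k)" using assms(3) k by simp
  ultimately show ?thesis
    using assms(1,4) by (simp add: layer_def funpow_Suc_right del: funpow.simps)
qed

lemma finite_layer: "finite (layer a1 a2 N k)"
proof -
  have "layer a1 a2 N k = {x. (p1 ^^ k) x = a1} \<times> {x. (p2 ^^ (N - k)) x = a2}"
    by (auto simp: layer_def)
  then show ?thesis by (simp add: T1.finite_descendants T2.finite_descendants)
qed

text \<open>Suppose the maximum \<open>M\<close> is positive. Then \<open>d < M\<close> holds on
  layer \<open>N\<close> and spreads down layer by layer: the part of the average over the layer
  above is strictly below its share of \<open>M\<close>, and that part has positive weight. So
  \<open>M\<close> would not be attained.\<close>

lemma maximum_principle:
  assumes sub: "\<And>k x1 x2. 0 < k \<Longrightarrow> k < N \<Longrightarrow> (x1, x2) \<in> layer a1 a2 N k \<Longrightarrow> d (x1, x2) \<le> avg d x1 x2"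
    and bdry: "\<And>z. z \<in> layer a1 a2 N 0 \<union> layer a1 a2 N N \<Longrightarrow> d z \<le> 0"
    and z: "k \<le> N" "z \<in> layer a1 a2 N k"
  shows "d z \<le> 0"
proof (rule ccontr)
  assume "\<not> d z \<le> 0"
  define S where "S = (\<Union>k\<le>N. layer a1 a2 N k)"
  define M where "M = Max (d ` S)"
  have fin: "finite S" by (simp add: S_def finite_layer)
  have "z \<in> S" using z by (auto simp: S_def)
  then have le_M: "d w \<le> M" if "w \<in> S" for w
    using fin that by (simp add: M_def)
  have "M > 0" using le_M[OF \<open>z \<in> S\<close>] \<open>\<not> d z \<le> 0\<close> by simp
  have less_M: "d w < M" if "k \<le> N" "w \<in> layer a1 a2 N k" for k w
    using that
  proof (induction "N - k" arbitrary: k w)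
    case 0
    then show ?case using bdry[of w] \<open>M > 0\<close> by force
  next
    case (Suc m)
    show ?case
    proof (cases "k = 0")
      case True
      then show ?thesis using Suc.prems bdry[of w] \<open>M > 0\<close> by force
    next
      case False
      obtain x1 x2 where w: "w = (x1, x2)" by fastforce
      have k: "0 < k" "k < N" using False Suc.hyps(2) by auto
      have up: "d (y, p2 x2) < M" if "p1 y = x1" for y
        using Suc.hyps(1)[of "Suc k"] Suc.hyps(2) k layer_up that Suc.prems(2) w by auto
      have down: "d (p1 x1, y) \<le> M" if "p2 y = x2" for y
        using layer_down[OF _ k(1) _ that] Suc.prems(2) k w
        by (intro le_M) (auto simp: S_def intro!: bexI[of _ "k - 1"])
      have "(\<Sum>y | p1 y = x1. d (y, p2 x2)) < (\<Sum>y | p1 y = x1. M)"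
        using up T1.finite_succ T1.ex_succ[of x1] by (intro sum_strict_mono) auto
      then have "(\<Sum>y | p1 y = x1. d (y, p2 x2)) < real q * M"
        by (simp add: T1.card_succ)
      then have 1: "\<alpha> / real q * (\<Sum>y | p1 y = x1. d (y, p2 x2)) < \<alpha> * M"
        using \<alpha> T1.q_pos by (simp add: field_simps)
      have "(\<Sum>y | p2 y = x2. d (p1 x1, y)) \<le> (\<Sum>y | p2 y = x2. M)"
        using down by (intro sum_mono) auto
      then have "(1 - \<alpha>) * (\<Sum>y | p2 y = x2. d (p1 x1, y)) \<le> (1 - \<alpha>) * (real r * M)"
        using \<alpha> by (intro mult_left_mono) (simp_all add: T2.card_succ)
      then have 2: "(1 - \<alpha>) / real r * (\<Sum>y | p2 y = x2. d (p1 x1, y)) \<le> (1 - \<alpha>) * M"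
        using T2.q_pos by (simp add: field_simps)
      have "d w \<le> avg d x1 x2"
        using sub[OF k] Suc.prems(2) w by simp
      also have "\<dots> < \<alpha> * M + (1 - \<alpha>) * M"
        unfolding avg_def using 1 2 by linarith
      finally show ?thesis by (simp add: algebra_simps)
    qed
  qed
  have "M \<in> d ` S" unfolding M_def using fin \<open>z \<in> S\<close> by (intro Max_in) auto
  then show False using less_M by (auto simp: S_def)
qed

lemma decomposition_on_tetrahedron:
  assumes h: "\<And>x1 x2. b1 x1 + b2 x2 = 0 \<Longrightarrow> 0 \<le> h (x1, x2)"
      "\<And>x1 x2. b1 x1 + b2 x2 = 0 \<Longrightarrow> avg h x1 x2 = h (x1, x2)"
    and N: "0 < N" "b1 a1 + b2 a2 = - int N"
  obtains u w where "\<And>x. 0 \<le> u x" "\<And>x. 0 \<le> w x"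
    "\<And>k x. 0 < k \<Longrightarrow> k < N \<Longrightarrow> (p1 ^^ k) x = a1 \<Longrightarrow> T1.avg \<alpha> u x = u x"
    "\<And>k x1 x2. k \<le> N \<Longrightarrow> (x1, x2) \<in> layer a1 a2 N k \<Longrightarrow> h (x1, x2) = u x1 + w x2"
proof -
  \<comment> \<open>\<open>I1\<close> and \<open>I2\<close> are the projections of the interior
    layers. The boundary data \<open>g1\<close> and \<open>g2\<close> carry \<open>h\<close> on one
    edge each and vanish elsewhere, in particular at the apexes.\<close>
  define I1 where "I1 = {x. \<exists>k. 0 < k \<and> k < N \<and> (p1 ^^ k) x = a1}"
  define I2 where "I2 = {x. \<exists>k. 0 < k \<and> k < N \<and> (p2 ^^ k) x = a2}"
  define g1 where "g1 x = (if (p1 ^^ N) x = a1 then h (x, a2) else 0)" for x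
  define g2 where "g2 x = (if (p2 ^^ N) x = a2 then h (a1, x) else 0)" for x
  have level: "b1 x1 + b2 x2 = 0" if "k \<le> N" "(x1, x2) \<in> layer a1 a2 N k" for k x1 x2
    using that N(2) T1.level_funpow[of k x1] T2.level_funpow[of "N - k" x2] by (auto simp: layer_def)
  have k1: "int k = b1 x - b1 a1" if "(p1 ^^ k) x = a1" for k x
    using T1.level_funpow[of k x] that by simp
  have k2: "int k = b2 x - b2 a2" if "(p2 ^^ k) x = a2" for k x
    using T2.level_funpow[of k x] that by simp
  have unique1: "i = k" if "(p1 ^^ i) x = a1" "(p1 ^^ k) x = a1" for i k x
    using k1[OF that(1)] k1[OF that(2)] by simp
  have unique2: "i = k" if "(p2 ^^ i) x = a2" "(p2 ^^ k) x = a2" for i k x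
    using k2[OF that(1)] k2[OF that(2)] by simp
  \<comment> \<open>The Dirichlet problem asks for a uniform bound; the sum of the finitely many
    non-negative boundary values provides one.\<close>
  have g1: "0 \<le> g1 x" "g1 x \<le> (\<Sum>y | (p1 ^^ N) y = a1. h (y, a2))" for x
  proof -
    have nn: "0 \<le> h (y, a2)" if "(p1 ^^ N) y = a1" for y
      using h(1) N(2) k1[OF that] by simp
    then show "0 \<le> g1 x" by (simp add: g1_def)
    show "g1 x \<le> (\<Sum>y | (p1 ^^ N) y = a1. h (y, a2))"
      using T1.finite_descendants nn
      by (auto simp: g1_def intro!: member_le_sum[of x _ "\<lambda>y. h (y, a2)"] sum_nonneg)
  qed
  have g2: "0 \<le> g2 x" "g2 x \<le> (\<Sum>y | (p2 ^^ N) y = a2. h (a1, y))" for x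
  proof -
    have nn: "0 \<le> h (a1, y)" if "(p2 ^^ N) y = a2" for y
      using h(1) N(2) k2[OF that] by simp
    then show "0 \<le> g2 x" by (simp add: g2_def)
    show "g2 x \<le> (\<Sum>y | (p2 ^^ N) y = a2. h (a1, y))"
      using T2.finite_descendants nn
      by (auto simp: g2_def intro!: member_le_sum[of x _ "\<lambda>y. h (a1, y)"] sum_nonneg)
  qed
  obtain u where u: "\<And>x. 0 \<le> u x" "\<And>x. x \<notin> I1 \<Longrightarrow> u x = g1 x" "\<And>x. x \<in> I1 \<Longrightarrow> u x = T1.avg \<alpha> u x"
    using T1.dirichlet_problem[of \<alpha> g1 _ I1] \<alpha> g1 by (metis less_imp_le)
  obtain w where w: "\<And>x. 0 \<le> w x" "\<And>x. x \<notin> I2 \<Longrightarrow> w x = g2 x"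
      "\<And>x. x \<in> I2 \<Longrightarrow> w x = T2.avg (1 - \<alpha>) w x"
    using T2.dirichlet_problem[of "1 - \<alpha>" g2 _ I2] \<alpha> g2
    by (metis diff_ge_0_iff_ge diff_le_eq le_add_same_cancel1 less_imp_le)
  define s where "s = (\<lambda>(x1, x2). u x1 + w x2)"
  have bdry: "h z = s z" if z_bdry: "z \<in> layer a1 a2 N 0 \<union> layer a1 a2 N N" for z
  proof -
    obtain x1 x2 where z: "z = (x1, x2)" by fastforce
    \<comment> \<open>Levels determine generations, so an apex is not its own descendant at positive
      depth and takes boundary value \<open>0\<close>.\<close>
    have root1: "(p1 ^^ k) a1 \<noteq> a1" and root2: "(p2 ^^ k) a2 \<noteq> a2" if "0 < k" for k
      using unique1[of k a1 0] unique2[of k a2 0] that by auto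
    consider "x1 = a1" "(p2 ^^ N) x2 = a2" | "(p1 ^^ N) x1 = a1" "x2 = a2"
      using z_bdry by (auto simp: z layer_def)
    then show ?thesis
    proof cases
      case 1
      have "x1 \<notin> I1" "g1 x1 = 0"
        using 1(1) root1 N(1) by (auto simp: I1_def g1_def)
      moreover have "x2 \<notin> I2"
        using unique2[OF 1(2)] by (auto simp: I2_def)
      ultimately show ?thesis using 1 by (simp add: z s_def u(2) w(2) g2_def)
    next
      case 2
      have "x2 \<notin> I2" "g2 x2 = 0"
        using 2(2) root2 N(1) by (auto simp: I2_def g2_def)
      moreover have "x1 \<notin> I1"
        using unique1[OF 2(1)] by (auto simp: I1_def)
      ultimately show ?thesis using 2 by (simp add: z s_def u(2) w(2) g1_def)
    qed
  qed
  have inner: "avg (\<lambda>z. h z - s z) x1 x2 = h (x1, x2) - s (x1, x2)"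
    if "0 < k" "k < N" "(x1, x2) \<in> layer a1 a2 N k" for k x1 x2
  proof -
    have "x1 \<in> I1" using that by (auto simp: layer_def I1_def)
    moreover have "x2 \<in> I2" using that by (auto simp: layer_def I2_def intro!: exI[of _ "N - k"])
    ultimately have "avg s x1 x2 = s (x1, x2)"
      unfolding s_def avg_separated using u(3) w(3) by simp
    moreover have "avg h x1 x2 = h (x1, x2)" 
      using h(2)[OF level[OF less_imp_le[OF that(2)] that(3)]] .
    ultimately show ?thesis by (simp add: avg_diff)
  qed
  have "h z = s z" if z: "k \<le> N" "z \<in> layer a1 a2 N k" for k z
  \<comment> \<open>The maximum principle is applied to \<open>h - s\<close> and to
    \<open>s - h\<close>.\<close>
  proof -
    have "h z - s z \<le> 0"
    proof (rule maximum_principle[where d = "\<lambda>z. h z - s z", OF _ _ z])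
      fix j x1 x2 assume "0 < j" "j < N" "(x1, x2) \<in> layer a1 a2 N j"
      then show "h (x1, x2) - s (x1, x2) \<le> avg (\<lambda>z. h z - s z) x1 x2"
        by (simp add: inner)
    qed (simp add: bdry)
    moreover have "s z - h z \<le> 0"
    proof (rule maximum_principle[where d = "\<lambda>z. s z - h z", OF _ _ z])
      fix j x1 x2 assume "0 < j" "j < N" "(x1, x2) \<in> layer a1 a2 N j"
      then have "avg (\<lambda>z. h z - s z) x1 x2 = h (x1, x2) - s (x1, x2)" by (rule inner)
      then show "s (x1, x2) - h (x1, x2) \<le> avg (\<lambda>z. s z - h z) x1 x2"
        by (simp add: avg_diff)
    qed (simp add: bdry)
    ultimately show ?thesis by simp
  qed
  then have "h (x1, x2) = u x1 + w x2" if "k \<le> N" "(x1, x2) \<in> layer a1 a2 N k" for k x1 x2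
    using that by (fastforce simp: s_def)
  moreover have "T1.avg \<alpha> u x = u x" if "0 < k" "k < N" "(p1 ^^ k) x = a1" for k x
    by (rule u(3)[symmetric]) (use that in \<open>auto simp: I1_def\<close>)
  ultimately show ?thesis using that u(1) w(1) by blast
qed

end

section \<open>Passage to the limit\<close>

text \<open>Tychonoff's theorem makes the product of the intervals compact. Stating the result
  through closed sets lets every eventual closed condition pass to \<open>g\<close> without choosing
  a subsequence.\<close>

lemma pointwise_cluster_point:
  fixes f :: "nat \<Rightarrow> 'a \<Rightarrow> real"
  assumes "\<And>n x. f n x \<in> {0..B x}"
  obtains g where "\<And>Q. closed Q \<Longrightarrow> \<forall>\<^sub>F n in sequentially. f n \<in> Q \<Longrightarrow> g \<in> Q"
proof -
  define K where "K = Pi\<^sub>E UNIV (\<lambda>x. {0..B x})"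
  have "compactin (product_topology (\<lambda>_. euclidean) UNIV) K"
    unfolding K_def compactin_PiE by simp
  then have "compact K"
    by (simp add: euclidean_product_topology)
  moreover have "\<forall>\<^sub>F g in filtermap f sequentially. g \<in> K"
    using assms by (simp add: eventually_filtermap K_def PiE_iff del: atLeastAtMost_iff)
  moreover have "filtermap f sequentially \<noteq> bot"
    by (simp add: filtermap_bot_iff)
  ultimately obtain g where g: "inf (nhds g) (filtermap f sequentially) \<noteq> bot"
    unfolding compact_filter by blast
  have "g \<in> Q" if "closed Q" "\<forall>\<^sub>F n in sequentially. f n \<in> Q" for Q
  proof (rule ccontr)
    assume "g \<notin> Q"
    then have "\<forall>\<^sub>F k in nhds g. k \<in> - Q"
      using that(1) by (intro eventually_nhds_in_open) auto
    moreover have "\<forall>\<^sub>F k in filtermap f sequentially. k \<in> Q"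
      using that(2) by (simp add: eventually_filtermap)
    ultimately have "\<forall>\<^sub>F k in inf (nhds g) (filtermap f sequentially). False"
      unfolding eventually_inf by blast
    then show False using g by (simp add: trivial_limit_def)
  qed
  then show ?thesis using that by blast
qed

context diestel_leader
begin

lemma decomposition:
  assumes h: "\<And>x1 x2. b1 x1 + b2 x2 = 0 \<Longrightarrow> 0 \<le> h (x1, x2)"
      "\<And>x1 x2. b1 x1 + b2 x2 = 0 \<Longrightarrow> avg h x1 x2 = h (x1, x2)"
  obtains h1 h2 where "\<And>x. 0 \<le> h1 x" "\<And>x. T1.avg \<alpha> h1 x = h1 x"
    "\<And>x. 0 \<le> h2 x" "\<And>x. T2.avg (1 - \<alpha>) h2 x = h2 x"
    "\<And>x1 x2. b1 x1 + b2 x2 = 0 \<Longrightarrow> h (x1, x2) = h1 x1 + h2 x2"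
proof -
  obtain v1 v2 where v: "b1 v1 + b2 v2 = 0"
    using T1.ex_level[of 0] T2.ex_level[of 0] by (metis add_0)
  \<comment> \<open>Projections of the interior of the \<open>n\<close>-th tetrahedron, whose apexes
    are the \<open>n\<close>-th ancestors of \<open>v1\<close> and \<open>v2\<close> and whose
    layers run up to \<open>2 * n\<close>.\<close>
  define J1 where "J1 n = {x. \<exists>k. 0 < k \<and> k < 2 * n \<and> (p1 ^^ k) x = (p1 ^^ n) v1}" for n
  define J2 where "J2 n = {x. \<exists>k. 0 < k \<and> k < 2 * n \<and> (p2 ^^ k) x = (p2 ^^ n) v2}" for n
  have ev1: "\<forall>\<^sub>F n in sequentially. x \<in> J1 n" for x
    using T1.eventually_ancestor[of x v1] by (simp add: J1_def)
  have ev2: "\<forall>\<^sub>F n in sequentially. x \<in> J2 n" for x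
    using T2.eventually_ancestor[of x v2] by (simp add: J2_def)
  have "\<exists>u w. (\<forall>x. 0 \<le> u x) \<and> (\<forall>x. 0 \<le> w x) \<and> (\<forall>x\<in>J1 n. T1.avg \<alpha> u x = u x) \<and>
      (\<forall>x1\<in>J1 n. \<forall>x2\<in>J2 n. b1 x1 + b2 x2 = 0 \<longrightarrow> h (x1, x2) = u x1 + w x2)" for n
  proof (cases "n = 0")
    case True
    then show ?thesis by (intro exI[of _ "\<lambda>_. 0"]) (simp add: J1_def)
  next
    case False
    have level: "b1 ((p1 ^^ n) v1) + b2 ((p2 ^^ n) v2) = - int (2 * n)"
      using v by (simp add: T1.level_funpow T2.level_funpow)
    have "0 < 2 * n" using False by simp
    then obtain u w where uw: "\<And>x. 0 \<le> u x" "\<And>x. 0 \<le> w x"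
      "\<And>k x. 0 < k \<Longrightarrow> k < 2 * n \<Longrightarrow> (p1 ^^ k) x = (p1 ^^ n) v1 \<Longrightarrow> T1.avg \<alpha> u x = u x"
      "\<And>k x1 x2. k \<le> 2 * n \<Longrightarrow> (x1, x2) \<in> layer ((p1 ^^ n) v1) ((p2 ^^ n) v2) (2 * n) k \<Longrightarrow>
        h (x1, x2) = u x1 + w x2"
      using decomposition_on_tetrahedron[of h, OF h _ level] by blast
    have "h (x1, x2) = u x1 + w x2"
      if x: "x1 \<in> J1 n" "x2 \<in> J2 n" "b1 x1 + b2 x2 = 0" for x1 x2
    proof -
      obtain k l where k: "k < 2 * n" "(p1 ^^ k) x1 = (p1 ^^ n) v1"
          and l: "l < 2 * n" "(p2 ^^ l) x2 = (p2 ^^ n) v2"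
        using x(1,2) by (auto simp: J1_def J2_def)
      have "b1 x1 - int k = b1 v1 - int n" "b2 x2 - int l = b2 v2 - int n"
        using k(2) l(2) T1.level_funpow T2.level_funpow by metis+
      \<comment> \<open>Opposite levels make the two depths add up to \<open>2 * n\<close>, which
        places the pair in layer \<open>k\<close>.\<close>
      then have "l = 2 * n - k" using x(3) v k(1) by linarith
      then show ?thesis using uw(4)[of k x1 x2] k l by (simp add: layer_def)
    qed
    moreover have "\<forall>x\<in>J1 n. T1.avg \<alpha> u x = u x" using uw(3) by (auto simp: J1_def)
    ultimately show ?thesis using uw(1,2) by blast
  qed
  then obtain u w where u: "\<And>n x. 0 \<le> u n x" and w: "\<And>n x. 0 \<le> w n x"
    and u_harm: "\<And>n x. x \<in> J1 n \<Longrightarrow> T1.avg \<alpha> (u n) x = u n x"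
    and uw: "\<And>n x1 x2. x1 \<in> J1 n \<Longrightarrow> x2 \<in> J2 n \<Longrightarrow> b1 x1 + b2 x2 = 0 \<Longrightarrow> h (x1, x2) = u n x1 + w n x2"
    by metis
  obtain s where s: "\<And>x1. b1 x1 + b2 (s x1) = 0"
  proof -
    have "\<exists>x2. b1 x1 + b2 x2 = 0" for x1
      using T2.ex_level[of "- b1 x1"] by (metis add.right_inverse)
    then show ?thesis using that by metis
  qed
  obtain t where t: "\<And>x2. b1 (t x2) + b2 x2 = 0"
  proof -
    have "\<exists>x1. b1 x1 + b2 x2 = 0" for x2
      using T1.ex_level[of "- b2 x2"] by (metis add.left_inverse)
    then show ?thesis using that by metis
  qed
  \<comment> \<open>The bound \<open>u n x \<le> h (x, s x)\<close> is known only inside the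
    \<open>n\<close>-th tetrahedron. Setting \<open>0\<close> elsewhere makes it hold for all
    \<open>n\<close>, and each value is altered for finitely many \<open>n\<close> only.\<close>
  define f where "f n x = (if x \<in> J1 n \<and> s x \<in> J2 n then u n x else 0)" for n x
  have f_u: "\<forall>\<^sub>F n in sequentially. f n x = u n x" for x
    using ev1[of x] ev2[of "s x"] by eventually_elim (simp add: f_def)
  have "f n x \<in> {0..h (x, s x)}" for n x
    using u[of n x] w[of n "s x"] uw[of x n "s x"] s[of x] h(1)[OF s[of x]] by (auto simp: f_def)
  then obtain h1 where h1: "\<And>Q. closed Q \<Longrightarrow> \<forall>\<^sub>F n in sequentially. f n \<in> Q \<Longrightarrow> h1 \<in> Q"
    using pointwise_cluster_point[of f "\<lambda>x. h (x, s x)"] by blast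
  have nonneg: "0 \<le> h1 x" for x
  proof -
    have "closed {g :: 'a \<Rightarrow> real. 0 \<le> g x}"
      by (intro closed_Collect_le continuous_on_const continuous_on_product_coordinates)
    moreover have "\<forall>\<^sub>F n in sequentially. f n \<in> {g. 0 \<le> g x}"
      using u by (simp add: f_def)
    ultimately show ?thesis using h1 by blast
  qed
  have harm: "T1.avg \<alpha> h1 x = h1 x" for x
  proof -
    have "closed {g. T1.avg \<alpha> g x = g x}"
      by (intro closed_Collect_eq T1.continuous_on_avg continuous_on_product_coordinates)
    moreover have "\<forall>\<^sub>F n in sequentially. \<forall>y\<in>{y. p1 y = x}. f n y = u n y"
      using f_u by (intro eventually_ball_finite T1.finite_succ) auto
    then have "\<forall>\<^sub>F n in sequentially. f n \<in> {g. T1.avg \<alpha> g x = g x}"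
      using f_u[of x] f_u[of "p1 x"] ev1[of x]
    proof eventually_elim
      case (elim n)
      then have "T1.avg \<alpha> (f n) x = T1.avg \<alpha> (u n) x" by (simp add: T1.avg_def)
      then show ?case using elim u_harm by simp
    qed
    ultimately show ?thesis using h1 by blast
  qed
  \<comment> \<open>The bound built into \<open>f\<close> concerns the partner \<open>s x1\<close>
    only. In the limit it holds for every partner, which makes \<open>h2\<close>
    non-negative.\<close>
  have le: "h1 x1 \<le> h (x1, x2)" if x: "b1 x1 + b2 x2 = 0" for x1 x2
  proof -
    have "closed {g :: 'a \<Rightarrow> real. g x1 \<le> h (x1, x2)}"
      by (intro closed_Collect_le continuous_on_const continuous_on_product_coordinates)
    moreover have "\<forall>\<^sub>F n in sequentially. f n \<in> {g. g x1 \<le> h (x1, x2)}"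
      using ev1[of x1] ev2[of x2] f_u[of x1]
    proof eventually_elim
      case (elim n)
      then show ?case using uw[OF elim(1,2) x] w[of n x2] by simp
    qed
    ultimately show ?thesis using h1 by blast
  qed
  \<comment> \<open>Before the limit, \<open>h (x1, x2) - u n x1\<close> is \<open>w n x2\<close>
    and so depends on \<open>x2\<close> alone; this is a closed condition on the first
    summand.\<close>
  have indep: "h (x1, x2) - h1 x1 = h (y1, x2) - h1 y1"
    if x: "b1 x1 + b2 x2 = 0" "b1 y1 + b2 x2 = 0" for x1 y1 x2
  proof -
    have "closed {g :: 'a \<Rightarrow> real. h (x1, x2) - g x1 = h (y1, x2) - g y1}"
      by (intro closed_Collect_eq continuous_on_diff continuous_on_const continuous_on_product_coordinates)
    moreover have "\<forall>\<^sub>F n in sequentially. f n \<in> {g. h (x1, x2) - g x1 = h (y1, x2) - g y1}"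
      using ev1[of x1] ev1[of y1] ev2[of x2] f_u[of x1] f_u[of y1]
    proof eventually_elim
      case (elim n)
      then show ?case using uw[OF elim(1,3) x(1)] uw[OF elim(2,3) x(2)] by simp
    qed
    ultimately show ?thesis using h1 by blast
  qed
  \<comment> \<open>Only the first summand is passed to the limit. The second is the difference,
    independent of the chosen partner \<open>t x\<close>, and inherits harmonicity from
    \<open>h\<close> and \<open>h1\<close>.\<close>
  define h2 where "h2 x = h (t x, x) - h1 (t x)" for x
  have sum: "h (x1, x2) = h1 x1 + h2 x2" if "b1 x1 + b2 x2 = 0" for x1 x2
    using indep[OF that t] by (simp add: h2_def)
  have "T2.avg (1 - \<alpha>) h2 x2 = h2 x2" for x2
  proof -
    let ?x1 = "t x2"
    have up: "h (y, p2 x2) = h1 y + h2 (p2 x2)" if "p1 y = ?x1" for y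
      using t[of x2] T1.level_pred[of y] that by (intro sum) (simp add: T2.level_pred)
    have down: "h (p1 ?x1, y) = h1 (p1 ?x1) + h2 y" if "p2 y = x2" for y
      using t[of x2] T2.level_pred[of y] that by (intro sum) (simp add: T1.level_pred)
    have "h (?x1, x2) = avg h ?x1 x2" using h(2)[OF t] by simp
    also have "\<dots> = avg (\<lambda>(y1, y2). h1 y1 + h2 y2) ?x1 x2"
      using up down by (simp add: avg_def)
    also have "\<dots> = h1 ?x1 + T2.avg (1 - \<alpha>) h2 x2"
      by (simp add: avg_separated harm)
    finally show ?thesis by (simp add: h2_def)
  qed
  moreover have "0 \<le> h2 x" for x using le[OF t] by (simp add: h2_def)
  ultimately show ?thesis using that nonneg harm sum by blast
qed

end

section \<open>Return to the original trees and transition matrices\<close>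

lemma homogeneous_tree_horocyclic:
  assumes "homogeneous_tree q E" and "\<omega> \<in> ends E" and "q > 0"
  shows "horocyclic_tree (predecessor E v \<omega>) (busemann E v \<omega>) q"
proof -
  obtain \<rho> where \<rho>: "\<rho> \<in> geodesic_rays E" "\<omega> = ray_equiv E `` {\<rho>}"
    using assms(2) by (auto simp: ends_def quotient_def)
  interpret tree_with_ray E q \<rho>
    using assms(1) \<rho>(1) by unfold_locales
  have \<omega>: "\<omega> = end_of_ray" by (simp add: \<rho>(2) end_of_ray_def)
  show ?thesis
    unfolding \<omega> predecessor_end busemann_end
    by unfold_locales (use assms(3) in \<open>simp_all add: horo_pred card_successors funpow_pred_confluent\<close>)
qed

theorem theorem2p10:
  fixes q r :: nat and \<alpha> :: real
    and E1 :: "'a \<Rightarrow> 'a \<Rightarrow> bool" and o1 :: 'a and \<omega>1 :: "(nat \<Rightarrow> 'a) set"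
    and E2 :: "'b \<Rightarrow> 'b \<Rightarrow> bool" and o2 :: 'b and \<omega>2 :: "(nat \<Rightarrow> 'b) set"
    and h :: "'a \<times> 'b \<Rightarrow> real"
  assumes "q \<ge> 2" and "r \<ge> 2" and "0 < \<alpha>" and "\<alpha> < 1"
    and "homogeneous_tree q E1" and "\<omega>1 \<in> ends E1"
    and "homogeneous_tree r E2" and "\<omega>2 \<in> ends E2"
    and "\<forall>x \<in> DL_verts E1 o1 \<omega>1 E2 o2 \<omega>2. h x \<ge> 0"
    and "harmonic_on (DL_verts E1 o1 \<omega>1 E2 o2 \<omega>2) (DL_walk q r \<alpha> E1 o1 \<omega>1 E2 o2 \<omega>2) h"
  shows "\<exists>(h1 :: 'a \<Rightarrow> real) (h2 :: 'b \<Rightarrow> real).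
    (\<forall>x1. h1 x1 \<ge> 0) \<and> harmonic_on UNIV (proj1_walk q \<alpha> E1 o1 \<omega>1) h1 \<and>
    (\<forall>x2. h2 x2 \<ge> 0) \<and> harmonic_on UNIV (proj2_walk r \<alpha> E2 o2 \<omega>2) h2 \<and>
    (\<forall>(x1, x2) \<in> DL_verts E1 o1 \<omega>1 E2 o2 \<omega>2. h (x1, x2) = h1 x1 + h2 x2)"
proof -
  define p1 where "p1 = predecessor E1 o1 \<omega>1"
  define p2 where "p2 = predecessor E2 o2 \<omega>2"
  define b1 where "b1 = busemann E1 o1 \<omega>1"
  define b2 where "b2 = busemann E2 o2 \<omega>2"
  define V where "V = DL_verts E1 o1 \<omega>1 E2 o2 \<omega>2"
  have "horocyclic_tree p1 b1 q" "horocyclic_tree p2 b2 r"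
    unfolding p1_def p2_def b1_def b2_def using assms by (auto intro: homogeneous_tree_horocyclic)
  then interpret diestel_leader p1 b1 q p2 b2 r \<alpha>
    using assms(3,4) by (simp add: diestel_leader_def diestel_leader_axioms_def)
  have V: "(x1, x2) \<in> V \<longleftrightarrow> b1 x1 + b2 x2 = 0" for x1 x2
    by (simp add: V_def DL_verts_def b1_def b2_def)
  \<comment> \<open>No vertex is its own second ancestor, so the two cases of each transition matrix
    exclude each other.\<close>
  have pp1: "p1 (p1 x) \<noteq> x" for x
    using T1.level_pred[of x] T1.level_pred[of "p1 x"] by auto
  have pp2: "p2 (p2 x) \<noteq> x" for x
    using T2.level_pred[of x] T2.level_pred[of "p2 x"] by auto
  have "avg h x1 x2 = h (x1, x2)" if x: "b1 x1 + b2 x2 = 0" for x1 x2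
  proof -
    define R where "R = (\<lambda>y. DL_walk q r \<alpha> E1 o1 \<omega>1 E2 o2 \<omega>2 (x1, x2) y * h y)"
    \<comment> \<open>\<open>A\<close> and \<open>B\<close> are the targets of the two kinds of
      steps from \<open>(x1, x2)\<close>. They contain the support of the transition row, so the
      infinite sum reduces to a finite one.\<close>
    define A where "A = (\<lambda>y. (y, p2 x2)) ` {y. p1 y = x1}"
    define B where "B = (\<lambda>y. (p1 x1, y)) ` {y. p2 y = x2}"
    have R: "R (y1, y2) = (if p1 y1 = x1 \<and> y2 = p2 x2 then \<alpha> / real q
        else if y1 = p1 x1 \<and> p2 y2 = x2 then (1 - \<alpha>) / real r else 0) * h (y1, y2)" for y1 y2
      unfolding R_def DL_walk_def p1_def p2_def prod.case ..
    have fin: "finite A" "finite B"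
      by (simp_all add: A_def B_def T1.finite_succ T2.finite_succ)
    have disj: "A \<inter> B = {}" using pp2 by (auto simp: A_def B_def)
    have "A \<union> B \<subseteq> V"
      using x T1.level_pred T2.level_pred by (fastforce simp: A_def B_def V)
    moreover have "R y = 0" if "y \<in> V - (A \<union> B)" for y
      using that by (cases y) (auto simp: R A_def B_def)
    ultimately have "(R has_sum sum R (A \<union> B)) V"
      using fin by (intro has_sum_finite_neutralI[of "A \<union> B"]) auto
    moreover have "(R has_sum h (x1, x2)) V"
      using assms(10) x V by (auto simp: harmonic_on_def R_def V_def)
    ultimately have "h (x1, x2) = sum R (A \<union> B)"
      using has_sum_unique by blast
    also have "\<dots> = sum R A + sum R B"
      using fin disj by (rule sum.union_disjoint)
    also have "sum R A = (\<Sum>y | p1 y = x1. \<alpha> / real q * h (y, p2 x2))"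
      unfolding A_def by (subst sum.reindex) (auto simp: inj_on_def R)
    also have "sum R B = (\<Sum>y | p2 y = x2. (1 - \<alpha>) / real r * h (p1 x1, y))"
      unfolding B_def using pp1 by (subst sum.reindex) (auto simp: inj_on_def R)
    finally show ?thesis by (simp add: avg_def sum_distrib_left)
  qed
  moreover have "0 \<le> h (x1, x2)" if "b1 x1 + b2 x2 = 0" for x1 x2
    using assms(9) that V by (auto simp: V_def)
  ultimately obtain h1 h2 where h12: "\<And>x. 0 \<le> h1 x" "\<And>x. T1.avg \<alpha> h1 x = h1 x"
    "\<And>x. 0 \<le> h2 x" "\<And>x. T2.avg (1 - \<alpha>) h2 x = h2 x"
    "\<And>x1 x2. b1 x1 + b2 x2 = 0 \<Longrightarrow> h (x1, x2) = h1 x1 + h2 x2"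
    using decomposition[of h] by blast
  have "harmonic_on UNIV (proj1_walk q \<alpha> E1 o1 \<omega>1) h1"
    unfolding harmonic_on_def
  proof
    fix x
    have "((\<lambda>y. proj1_walk q \<alpha> E1 o1 \<omega>1 x y * h1 y) has_sum T1.avg \<alpha> h1 x) UNIV"
    proof (rule has_sum_finite_neutralI)
      show "finite (insert (p1 x) {y. p1 y = x})" by (simp add: T1.finite_succ)
      show "T1.avg \<alpha> h1 x =
          (\<Sum>y\<in>insert (p1 x) {y. p1 y = x}. proj1_walk q \<alpha> E1 o1 \<omega>1 x y * h1 y)"
        using pp1 by (simp add: T1.finite_succ T1.avg_def proj1_walk_def sum_distrib_left flip: p1_def)
    qed (auto simp: proj1_walk_def simp flip: p1_def)
    then show "((\<lambda>y. proj1_walk q \<alpha> E1 o1 \<omega>1 x y * h1 y) has_sum h1 x) UNIV"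
      by (simp only: h12(2))
  qed
  moreover have "harmonic_on UNIV (proj2_walk r \<alpha> E2 o2 \<omega>2) h2"
    unfolding harmonic_on_def
  proof
    fix x
    \<comment> \<open>\<open>proj2_walk\<close> tests for the predecessor first, so a successor must
      be known to differ from it.\<close>
    have ne: "y \<noteq> p2 x" if "p2 y = x" for y using pp2[of x] that by auto
    have "((\<lambda>y. proj2_walk r \<alpha> E2 o2 \<omega>2 x y * h2 y) has_sum T2.avg (1 - \<alpha>) h2 x) UNIV"
    proof (rule has_sum_finite_neutralI)
      show "finite (insert (p2 x) {y. p2 y = x})" by (simp add: T2.finite_succ)
      show "T2.avg (1 - \<alpha>) h2 x =
          (\<Sum>y\<in>insert (p2 x) {y. p2 y = x}. proj2_walk r \<alpha> E2 o2 \<omega>2 x y * h2 y)"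
        using pp2 ne
        by (simp add: T2.finite_succ T2.avg_def proj2_walk_def sum_distrib_left flip: p2_def)
    qed (auto simp: proj2_walk_def simp flip: p2_def)
    then show "((\<lambda>y. proj2_walk r \<alpha> E2 o2 \<omega>2 x y * h2 y) has_sum h2 x) UNIV"
      by (simp only: h12(4))
  qed
  moreover have "\<forall>(x1, x2) \<in> V. h (x1, x2) = h1 x1 + h2 x2"
    using h12(5) V by auto
  ultimately show ?thesis using h12(1,3) unfolding V_def by blast
qed

end
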